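(* Let $k\ge 2$ be an integer and let $G$ and $H$ be graphs. If $H$ admits a neighborhood-balanced $k$-coloring $c$ such that $|V_i^c(H)|=|V_j^c(H)|$ for all $i,j\in\{1,\dots,k\}$, then the lexicographic product $G[H]$ admits a neighborhood-balanced $k$-coloring.
   Context: All graphs are finite, simple and undirected. A neighborhood-balanced $k$-coloring of a graph is a (not necessarily proper) vertex coloring with colors $1,\dots,k$ such that every vertex has the same number of neighbors of each of the $k$ colors. $V_i^c(H)$ denotes the set of vertices of $H$ with color $i$ under $c$. The lexicographic product $G[H]$ has vertex set $V(G)\times V(H)$, and $(u,v)$ and $(u',v')$ are adjacent if and only if either $uu'\in E(G)$, or $u=u'$ and $vv'\in E(H)$. *)

theory Defs
  imports "Graph_Theory.Pair_Digraph"
begin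

text \<open>
  A finite simple undirected graph is a \<^locale>\<open>pair_graph\<close>: an edge \<open>uv\<close> is represented by the
  two arcs \<open>(u, v)\<close> and \<open>(v, u)\<close>. The graph without vertices is admitted.
\<close>

definition neighborhood :: "'a pair_pre_digraph \<Rightarrow> 'a \<Rightarrow> 'a set" where
  "neighborhood G u = {v \<in> pverts G. (u, v) \<in> parcs G}"

definition color_class :: "'a pair_pre_digraph \<Rightarrow> ('a \<Rightarrow> nat) \<Rightarrow> nat \<Rightarrow> 'a set" where
  "color_class G c i = {v \<in> pverts G. c v = i}"

text \<open>
  Only the values of \<open>c\<close> on the vertices of the graph matter, and not every color has to be used.
\<close>

definition neighborhood_balanced_coloring ::
    "nat \<Rightarrow> 'a pair_pre_digraph \<Rightarrow> ('a \<Rightarrow> nat) \<Rightarrow> bool" where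
  "neighborhood_balanced_coloring k G c \<longleftrightarrow>
     (\<forall>v \<in> pverts G. c v \<in> {1..k}) \<and>
     (\<forall>u \<in> pverts G. \<forall>i \<in> {1..k}. \<forall>j \<in> {1..k}.
        card (neighborhood G u \<inter> color_class G c i) =
        card (neighborhood G u \<inter> color_class G c j))"

definition lexicographic_product ::
    "'a pair_pre_digraph \<Rightarrow> 'b pair_pre_digraph \<Rightarrow> ('a \<times> 'b) pair_pre_digraph" where
  "lexicographic_product G H =
     \<lparr> pverts = pverts G \<times> pverts H,
       parcs = {((u, v), (u', v')) | u v u' v'.
         u \<in> pverts G \<and> v \<in> pverts H \<and> u' \<in> pverts G \<and> v' \<in> pverts H \<and>
         ((u, u') \<in> parcs G \<or> u = u' \<and> (v, v') \<in> parcs H)} \<rparr>"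

lemma pair_graph_lexicographic_product:
  assumes "pair_graph G" and "pair_graph H"
  shows "pair_graph (lexicographic_product G H)"
proof -
  interpret G: pair_graph G by (rule assms)
  interpret H: pair_graph H by (rule assms)
  let ?P = "lexicographic_product G H"
  have "parcs ?P \<subseteq> pverts ?P \<times> pverts ?P"
    by (auto simp: lexicographic_product_def)
  moreover have fin: "finite (pverts ?P)"
    by (simp add: lexicographic_product_def)
  ultimately have "finite (parcs ?P)"
    by (meson finite_SigmaI finite_subset)
  with fin show ?thesis
    by unfold_locales
      (auto simp: lexicographic_product_def symmetric_def sym_def arcs_ends_conv
        dest: G.arcs_symmetric H.arcs_symmetric G.no_loops' H.no_loops')
qed

end

theory Submission
  imports Defs
begin

text \<open>
  Color \<open>(u, v)\<close> in the product by the color of \<open>v\<close>. The neighborhood of \<open>(u, v)\<close> consists of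
  complete copies of \<open>H\<close>, one above each neighbor of \<open>u\<close> in \<open>G\<close>, and of one copy of the
  neighborhood of \<open>v\<close>, lying above \<open>u\<close> itself. Each complete copy contains every color equally
  often because the color classes of \<open>H\<close> are equally large, and the copy above \<open>u\<close> does so because
  the coloring of \<open>H\<close> is neighborhood-balanced. These pieces are disjoint since \<open>G\<close> has no loops,
  so their color counts add up.
\<close>

lemma neighborhood_lexicographic_product_Int_color_class:
  assumes "u \<in> pverts G" and "v \<in> pverts H"
  shows "neighborhood (lexicographic_product G H) (u, v)
           \<inter> color_class (lexicographic_product G H) (c \<circ> snd) i =
         neighborhood G u \<times> color_class H c i \<union> {u} \<times> (neighborhood H v \<inter> color_class H c i)"
  using assms by (auto simp: neighborhood_def color_class_def lexicographic_product_def)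

lemma card_neighborhood_lexicographic_product_Int_color_class:
  assumes "pair_graph G" and "pair_graph H" and "u \<in> pverts G" and "v \<in> pverts H"
  shows "card (neighborhood (lexicographic_product G H) (u, v)
           \<inter> color_class (lexicographic_product G H) (c \<circ> snd) i) =
         card (neighborhood G u) * card (color_class H c i)
           + card (neighborhood H v \<inter> color_class H c i)"
proof -
  interpret G: pair_graph G by (rule assms)
  interpret H: pair_graph H by (rule assms)
  have "finite (neighborhood G u)" and "finite (color_class H c i)"
    by (auto simp: neighborhood_def color_class_def)
  moreover have "u \<notin> neighborhood G u"
    by (auto simp: neighborhood_def dest: G.no_loops')
  then have "(neighborhood G u \<times> color_class H c i)
      \<inter> ({u} \<times> (neighborhood H v \<inter> color_class H c i)) = {}"
    by auto
  ultimately show ?thesis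
    using assms(3,4)
    by (simp add: neighborhood_lexicographic_product_Int_color_class card_Un_disjoint
        card_cartesian_product)
qed

theorem theorem3p2:
  fixes k :: nat
    and G :: "'a pair_pre_digraph"
    and H :: "'b pair_pre_digraph"
  assumes "k \<ge> 2"
    and "pair_graph G"
    and "pair_graph H"
    and "\<exists>c. neighborhood_balanced_coloring k H c \<and>
           (\<forall>i \<in> {1..k}. \<forall>j \<in> {1..k}. card (color_class H c i) = card (color_class H c j))"
  shows "\<exists>d. neighborhood_balanced_coloring k (lexicographic_product G H) d"
proof -
  obtain c where balanced: "neighborhood_balanced_coloring k H c"
    and equal_classes:
      "\<forall>i \<in> {1..k}. \<forall>j \<in> {1..k}. card (color_class H c i) = card (color_class H c j)"
    using assms(4) by blast
  let ?P = "lexicographic_product G H"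
  have verts: "pverts ?P = pverts G \<times> pverts H"
    by (simp add: lexicographic_product_def)
  have "neighborhood_balanced_coloring k ?P (c \<circ> snd)"
    unfolding neighborhood_balanced_coloring_def
  proof (intro conjI ballI)
    fix x assume "x \<in> pverts ?P"
    then show "(c \<circ> snd) x \<in> {1..k}"
      using balanced by (auto simp: verts neighborhood_balanced_coloring_def)
  next
    fix x i j assume "x \<in> pverts ?P" and ij: "i \<in> {1..k}" "j \<in> {1..k}"
    then obtain u v where x: "x = (u, v)" and uv: "u \<in> pverts G" "v \<in> pverts H"
      by (auto simp: verts)
    have "card (color_class H c i) = card (color_class H c j)"
      using equal_classes ij by blast
    moreover have "card (neighborhood H v \<inter> color_class H c i) =
        card (neighborhood H v \<inter> color_class H c j)"
      using balanced uv(2) ij unfolding neighborhood_balanced_coloring_def by blast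
    ultimately show "card (neighborhood ?P x \<inter> color_class ?P (c \<circ> snd) i) =
        card (neighborhood ?P x \<inter> color_class ?P (c \<circ> snd) j)"
      unfolding x card_neighborhood_lexicographic_product_Int_color_class[OF assms(2,3) uv]
      by simp
  qed
  then show ?thesis by blast
qed

end
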